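(* Let $p$ be a prime number and $\alpha\in\mathrm{SL}_2(\mathbb{Z})$. Set $\gamma_0=\mathrm{id}$ and $\gamma_j=\begin{pmatrix}0&-1\\1&j\end{pmatrix}$ for $j=1,\dots,p$, let $d_j$ be the size of the $\langle\alpha\rangle$-orbit of $[0,1]\gamma_j$ in $\mathbb{P}^1(\mathbb{F}_p)$, and let $S_\alpha\subseteq\{0,\dots,p\}$ be a set of indices such that $\{[0,1]\gamma_k:k\in S_\alpha\}$ is a set of representatives of the $\langle\alpha\rangle$-orbits on $\mathbb{P}^1(\mathbb{F}_p)$. Let $g_p=\begin{pmatrix}p&0\\0&1\end{pmatrix}$. Then, denoting conjugacy classes by their representatives, $$\pi^*(\alpha)=\sum_{k\in S_\alpha}\gamma_k\alpha^{d_k}\gamma_k^{-1}=\sum_{j=0}^p(\gamma_j\alpha^{d_j}\gamma_j^{-1})/d_j\in\mathbb{Z}\lambda(\Gamma_0(p)),$$ $$\mathbf{e}_p(\alpha)=-\alpha+\sum_{k\in S_\alpha}\alpha^{d_k}=-\alpha+\sum_{j=0}^p\alpha^{d_j}/d_j\in\mathbb{Z}\lambda(\mathrm{SL}_2(\mathbb{Z})),$$ $$T_p(\alpha)=\sum_{k\in S_\alpha}(g_p\gamma_k)\alpha^{d_k}(g_p\gamma_k)^{-1}=\sum_{j=0}^p(g_p\gamma_j\alpha^{d_j}(g_p\gamma_j)^{-1})/d_j\in\mathbb{Z}\lambda(\mathrm{SL}_2(\mathbb{Z})).$$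
   Context: For a group $\Gamma$, $\lambda(\Gamma)$ is its set of conjugacy classes and $\mathbb{Z}\lambda(\Gamma)$ the free abelian group on it. A homomorphism $\psi$ induces $\psi_*$ on $\mathbb{Z}\lambda$. For a finite index subgroup $\pi:\Gamma'\hookrightarrow\Gamma$, the pullback $\pi^*:\mathbb{Z}\lambda(\Gamma)\to\mathbb{Z}\lambda(\Gamma')$ takes $[\alpha]$ to $\sum_{s\in\Gamma'\backslash\Gamma/\langle\alpha\rangle}[\gamma_s\alpha^{d_s}\gamma_s^{-1}]$, with $\gamma_s$ representing $s$ and $d_s=\min\{k>0:\gamma_s\alpha^k\gamma_s^{-1}\in\Gamma'\}$ (topologically, the sum of the closed loops covering $\alpha$ in the corresponding finite covering). Here $\pi:\Gamma_0(p)\hookrightarrow\mathrm{SL}_2(\mathbb{Z})$ is the inclusion of the subgroup of matrices upper triangular mod $p$; $\mathbf{e}_p=\pi_*\pi^*-\mathrm{id}$. The Hecke operator $T_p$ is $(\pi_p^{op})_*\circ\pi_p^*$ for the correspondence $\mathcal{M}_{1,1}\leftarrow\mathrm{Cov}_p\to\mathcal{M}_{1,1}$, where $\mathcal{M}_{1,1}=\mathrm{SL}_2(\mathbb{Z})\backslash\mathfrak{h}$ is the orbifold of lattices in $\mathbb{C}$ up to scaling, $\mathrm{Cov}_p$ is the orbifold of pairs of lattices $(\Lambda\supset\Lambda')$ of index $p$ up to scaling, $\pi_p(\Lambda,\Lambda')=\Lambda$ and $\pi_p^{op}(\Lambda,\Lambda')=\Lambda'$; in group-theoretic terms $T_p=\pi^{op}_*\circ\pi^*$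 with $\pi^{op}:\Gamma_0(p)\to\mathrm{SL}_2(\mathbb{Z})$, $\gamma\mapsto g_p\gamma g_p^{-1}$. $\mathrm{SL}_2(\mathbb{Z})$ acts on $\mathbb{P}^1(\mathbb{F}_p)$ on the right by $[u,v]\gamma=[(u,v)\gamma]$. *)

theory Defs
  imports
    "HOL-Analysis.Determinants"
    "HOL-Algebra.Free_Abelian_Groups"
    "HOL-Computational_Algebra.Primes"
begin

section \<open>Free abelian groups on conjugacy classes\<close>

definition conj_class :: "('a, 'm) monoid_scheme \<Rightarrow> 'a \<Rightarrow> 'a set" where
  "conj_class G a = {g \<otimes>\<^bsub>G\<^esub> a \<otimes>\<^bsub>G\<^esub> inv\<^bsub>G\<^esub> g | g. g \<in> carrier G}"

definition conj_classes :: "('a, 'm) monoid_scheme \<Rightarrow> 'a set set" where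
  "conj_classes G = conj_class G ` carrier G"

definition Z_lambda :: "('a, 'm) monoid_scheme \<Rightarrow> ('a set \<Rightarrow>\<^sub>0 int) set" where
  "Z_lambda G = carrier (free_Abelian_group (conj_classes G))"

definition cls :: "('a, 'm) monoid_scheme \<Rightarrow> 'a \<Rightarrow> ('a set \<Rightarrow>\<^sub>0 int)" where
  "cls G a = frag_of (conj_class G a)"

text \<open>Formal sums with denominators live in the free rational vector space on the conjugacy
  classes, which contains the free abelian group through \<open>to_rat\<close>.\<close>

definition qcls :: "('a, 'm) monoid_scheme \<Rightarrow> 'a \<Rightarrow> rat \<Rightarrow> ('a set \<Rightarrow>\<^sub>0 rat)" where
  "qcls G a q = Poly_Mapping.single (conj_class G a) q"

definition to_rat :: "('b \<Rightarrow>\<^sub>0 int) \<Rightarrow> ('b \<Rightarrow>\<^sub>0 rat)" where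
  "to_rat = Poly_Mapping.map rat_of_int"

definition push ::
  "('b, 'n) monoid_scheme \<Rightarrow> ('a \<Rightarrow> 'b) \<Rightarrow> ('a set \<Rightarrow>\<^sub>0 int) \<Rightarrow> ('b set \<Rightarrow>\<^sub>0 int)" where
  "push K \<psi> = frag_extend (\<lambda>C. cls K (\<psi> (SOME a. a \<in> C)))"

definition double_cosets :: "('a, 'm) monoid_scheme \<Rightarrow> 'a set \<Rightarrow> 'a \<Rightarrow> 'a set set" where
  "double_cosets G H a =
     {(H #>\<^bsub>G\<^esub> g) <#>\<^bsub>G\<^esub> generate G {a} | g. g \<in> carrier G}"

definition return_exp :: "('a, 'm) monoid_scheme \<Rightarrow> 'a set \<Rightarrow> 'a \<Rightarrow> 'a \<Rightarrow> nat" where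
  "return_exp G H a g =
     (LEAST k. 0 < k \<and> g \<otimes>\<^bsub>G\<^esub> (a [^]\<^bsub>G\<^esub> k) \<otimes>\<^bsub>G\<^esub> inv\<^bsub>G\<^esub> g \<in> H)"

text \<open>Pullback along the inclusion of a finite index subgroup \<open>H\<close> of \<open>G\<close>. A representative is chosen
  of the conjugacy class and of each double coset; the result does not depend on these choices.\<close>

definition pull ::
  "('a, 'm) monoid_scheme \<Rightarrow> 'a set \<Rightarrow> ('a set \<Rightarrow>\<^sub>0 int) \<Rightarrow> ('a set \<Rightarrow>\<^sub>0 int)" where
  "pull G H = frag_extend (\<lambda>C.
     let a = (SOME a. a \<in> C) in
     \<Sum>s\<in>double_cosets G H a.
       let g = (SOME g. g \<in> s) in
       cls (G\<lparr>carrier := H\<rparr>)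
         (g \<otimes>\<^bsub>G\<^esub> (a [^]\<^bsub>G\<^esub> return_exp G H a g) \<otimes>\<^bsub>G\<^esub> inv\<^bsub>G\<^esub> g))"


section \<open>The modular group\<close>

definition SL2Z :: "(int^2^2) monoid" where
  "SL2Z = \<lparr>carrier = {A. det A = 1}, monoid.mult = (**), one = mat 1\<rparr>"

definition Gamma0 :: "nat \<Rightarrow> (int^2^2) set" where
  "Gamma0 p = {A \<in> carrier SL2Z. int p dvd A $ 2 $ 1}"

abbreviation Gamma0_grp :: "nat \<Rightarrow> (int^2^2) monoid" where
  "Gamma0_grp p \<equiv> SL2Z\<lparr>carrier := Gamma0 p\<rparr>"

definition g_mat :: "nat \<Rightarrow> int^2^2" where
  "g_mat p = vector [vector [int p, 0], vector [0, 1]]"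

definition gamma_mat :: "nat \<Rightarrow> int^2^2" where
  "gamma_mat j = (if j = 0 then mat 1 else vector [vector [0, -1], vector [1, int j]])"

definition rat_mat :: "int^2^2 \<Rightarrow> rat^2^2" where
  "rat_mat = map_matrix rat_of_int"

text \<open>The conjugate \<open>h A h\<inverse>\<close> is formed over the rationals; \<open>int_conj h A\<close> is the integer matrix
  equal to it, and is meaningful only if that conjugate is integral.\<close>

definition conj_eq :: "int^2^2 \<Rightarrow> int^2^2 \<Rightarrow> int^2^2 \<Rightarrow> bool" where
  "conj_eq h A B \<longleftrightarrow> rat_mat B = rat_mat h ** rat_mat A ** matrix_inv (rat_mat h)"

definition int_conj :: "int^2^2 \<Rightarrow> int^2^2 \<Rightarrow> int^2^2" where
  "int_conj h A = (THE B. conj_eq h A B)"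

definition pi_op :: "nat \<Rightarrow> int^2^2 \<Rightarrow> int^2^2" where
  "pi_op p = int_conj (g_mat p)"

definition pi_pull :: "nat \<Rightarrow> ((int^2^2) set \<Rightarrow>\<^sub>0 int) \<Rightarrow> ((int^2^2) set \<Rightarrow>\<^sub>0 int)" where
  "pi_pull p = pull SL2Z (Gamma0 p)"

definition e_op :: "nat \<Rightarrow> ((int^2^2) set \<Rightarrow>\<^sub>0 int) \<Rightarrow> ((int^2^2) set \<Rightarrow>\<^sub>0 int)" where
  "e_op p x = push SL2Z (\<lambda>A. A) (pi_pull p x) - x"

definition hecke_T :: "nat \<Rightarrow> ((int^2^2) set \<Rightarrow>\<^sub>0 int) \<Rightarrow> ((int^2^2) set \<Rightarrow>\<^sub>0 int)" where
  "hecke_T p x = push SL2Z (pi_op p) (pi_pull p x)"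


section \<open>The projective line over the field with p elements\<close>

text \<open>Vectors over the field with \<open>p\<close> elements are integer vectors with entries in
  \<open>{0..<p}\<close>; a point of the projective line is the set of nonzero multiples of a nonzero vector.\<close>

definition red :: "nat \<Rightarrow> int^2 \<Rightarrow> int^2" where
  "red p v = (\<chi> i. v $ i mod int p)"

definition P1_point :: "nat \<Rightarrow> int^2 \<Rightarrow> (int^2) set" where
  "P1_point p v = {red p (l *s v) | l. \<not> int p dvd l}"

definition P1 :: "nat \<Rightarrow> (int^2) set set" where
  "P1 p = {P1_point p v | v. red p v \<noteq> 0}"

definition P1_act :: "nat \<Rightarrow> (int^2) set \<Rightarrow> int^2^2 \<Rightarrow> (int^2) set" where
  "P1_act p P A = (\<lambda>w. red p (w v* A)) ` P"

definition P1_orbit :: "nat \<Rightarrow> int^2^2 \<Rightarrow> (int^2) set \<Rightarrow> (int^2) set set" where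
  "P1_orbit p \<alpha> P = P1_act p P ` generate SL2Z {\<alpha>}"

definition base_translate :: "nat \<Rightarrow> nat \<Rightarrow> (int^2) set" where
  "base_translate p j = P1_act p (P1_point p (vector [0, 1])) (gamma_mat j)"

definition orbit_reps :: "nat \<Rightarrow> int^2^2 \<Rightarrow> (int^2) set set \<Rightarrow> bool" where
  "orbit_reps p \<alpha> R \<longleftrightarrow> R \<subseteq> P1 p \<and> (\<forall>Q \<in> P1_orbit p \<alpha> ` P1 p. \<exists>!P. P \<in> R \<and> P \<in> Q)"

end

theory Submission
  imports Defs
begin

text \<open>
  The bottom row of a matrix identifies the right cosets of \<open>Gamma0 p\<close> in the modular group with the
  projective line over the field with \<open>p\<close> elements, equivariantly for right multiplication. Under this
  identification double cosets become orbits of \<open>\<alpha>\<close>, and the return exponent of a double coset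
  becomes the size of its orbit. Two points of one orbit give conjugate elements of \<open>Gamma0 p\<close>, since
  powers of \<open>\<alpha>\<close> commute; this makes the pullback independent of representatives, and averaging over
  each orbit turns the sum over representatives into the sum over all \<open>p + 1\<close> points with
  denominators \<open>d j\<close>. The formulas for \<open>e_op\<close> and \<open>hecke_T\<close> follow by pushing forward along
  homomorphisms.
\<close>

section \<open>Formal sums of conjugacy classes\<close>

text \<open>Together with \<open>m_assoc\<close>, these rules cancel adjacent inverse factors in
  products bracketed to the right.\<close>

lemma (in group) mult_inv_cancel:
  assumes "x \<in> carrier G" "y \<in> carrier G"
  shows "x \<otimes> (inv x \<otimes> y) = y" "inv x \<otimes> (x \<otimes> y) = y"
  using assms by (simp_all flip: m_assoc)

lemma (in group) conj_class_eq:
  assumes "a \<in> carrier G" "g \<in> carrier G"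
  shows "conj_class G (g \<otimes> a \<otimes> inv g) = conj_class G a"
proof (intro Set.set_eqI iffI)
  fix x assume "x \<in> conj_class G (g \<otimes> a \<otimes> inv g)"
  then obtain h where h: "h \<in> carrier G" "x = h \<otimes> (g \<otimes> a \<otimes> inv g) \<otimes> inv h"
    by (auto simp: conj_class_def)
  then have "x = (h \<otimes> g) \<otimes> a \<otimes> inv (h \<otimes> g)"
    using assms by (simp add: inv_mult_group m_assoc)
  then show "x \<in> conj_class G a"
    using h assms by (auto simp: conj_class_def)
next
  fix x assume "x \<in> conj_class G a"
  then obtain h where h: "h \<in> carrier G" "x = h \<otimes> a \<otimes> inv h"
    by (auto simp: conj_class_def)
  then have "x = (h \<otimes> inv g) \<otimes> (g \<otimes> a \<otimes> inv g) \<otimes> inv (h \<otimes> inv g)"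
    using assms by (simp add: inv_mult_group m_assoc mult_inv_cancel)
  then show "x \<in> conj_class G (g \<otimes> a \<otimes> inv g)"
    unfolding conj_class_def using h assms by blast
qed

text \<open>\<open>push\<close> and \<open>pull\<close> pick a member of a class by
  \<open>SOME\<close>; all that is known of the choice is that it is a conjugate of
  \<open>a\<close>.\<close>

lemma (in group) some_in_conj_class:
  assumes "a \<in> carrier G"
  obtains g where "g \<in> carrier G" "(SOME x. x \<in> conj_class G a) = g \<otimes> a \<otimes> inv g"
proof -
  have "\<one> \<otimes> a \<otimes> inv \<one> \<in> conj_class G a"
    unfolding conj_class_def by blast
  then have "(SOME x. x \<in> conj_class G a) \<in> conj_class G a"
    by (rule someI)
  then show ?thesis
    using that by (auto simp: conj_class_def)
qed

text \<open>This is what makes \<open>push\<close> well defined: a homomorphism carries a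
  conjugation in \<open>G\<close> to a conjugation in \<open>K\<close>.\<close>

lemma conj_class_hom:
  assumes "group G" "group K" "\<psi> \<in> hom G K" "a \<in> carrier G" "b \<in> carrier G"
    and "conj_class G a = conj_class G b"
  shows "conj_class K (\<psi> a) = conj_class K (\<psi> b)"
proof -
  interpret group_hom G K \<psi>
    using assms by (simp add: group_hom_def group_hom_axioms_def)
  have "\<one>\<^bsub>G\<^esub> \<otimes>\<^bsub>G\<^esub> a \<otimes>\<^bsub>G\<^esub> inv\<^bsub>G\<^esub> \<one>\<^bsub>G\<^esub> \<in> conj_class G a"
    unfolding conj_class_def by blast
  then have "a \<in> conj_class G b"
    using assms by simp
  then obtain g where "g \<in> carrier G" "a = g \<otimes>\<^bsub>G\<^esub> b \<otimes>\<^bsub>G\<^esub> inv\<^bsub>G\<^esub> g"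
    by (auto simp: conj_class_def)
  then show ?thesis
    using assms by (simp add: H.conj_class_eq)
qed

text \<open>The member chosen inside \<open>push\<close> differs from \<open>a\<close> by a
  conjugation, which the target class does not see.\<close>

lemma push_cls:
  assumes "group G" "group K" "\<psi> \<in> hom G K" "a \<in> carrier G"
  shows "push K \<psi> (cls G a) = cls K (\<psi> a)"
proof -
  interpret group G by fact
  obtain g where g: "g \<in> carrier G" "(SOME x. x \<in> conj_class G a) = g \<otimes>\<^bsub>G\<^esub> a \<otimes>\<^bsub>G\<^esub> inv\<^bsub>G\<^esub> g"
    using some_in_conj_class assms(4) by blast
  have "conj_class K (\<psi> (g \<otimes>\<^bsub>G\<^esub> a \<otimes>\<^bsub>G\<^esub> inv\<^bsub>G\<^esub> g)) = conj_class K (\<psi> a)"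
    using assms g by (intro conj_class_hom[OF assms(1-3)] conj_class_eq) auto
  then show ?thesis
    using g by (simp add: push_def cls_def)
qed

lemma push_sum: "push K \<psi> (sum f A) = (\<Sum>i\<in>A. push K \<psi> (f i))"
  by (induction A rule: infinite_finite_induct) (auto simp: push_def frag_extend_add)

section \<open>Closure properties of \<open>Z_lambda\<close> and passage to rational
  coefficients\<close>

lemma cls_in_Z_lambda: "a \<in> carrier G \<Longrightarrow> cls G a \<in> Z_lambda G"
  by (auto simp: Z_lambda_def cls_def conj_classes_def free_Abelian_group_def)

lemma Z_lambda_diff: "x \<in> Z_lambda G \<Longrightarrow> y \<in> Z_lambda G \<Longrightarrow> x - y \<in> Z_lambda G"
  using keys_diff[of x y] by (auto simp: Z_lambda_def free_Abelian_group_def)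

lemma Z_lambda_sum: "(\<And>i. i \<in> A \<Longrightarrow> f i \<in> Z_lambda G) \<Longrightarrow> sum f A \<in> Z_lambda G"
  unfolding Z_lambda_def free_Abelian_group_def
  using subset_trans[OF keys_sum[of f A]] by (auto simp: UN_subset_iff)

lemma lookup_to_rat: "Poly_Mapping.lookup (to_rat x) c = rat_of_int (Poly_Mapping.lookup x c)"
  by (simp add: to_rat_def map.rep_eq when_def)

lemma to_rat_diff: "to_rat (x - y) = to_rat x - to_rat y"
  by (rule poly_mapping_eqI) (simp add: lookup_to_rat lookup_minus)

lemma to_rat_sum: "to_rat (sum f A) = (\<Sum>i\<in>A. to_rat (f i))"
  by (rule poly_mapping_eqI) (simp add: lookup_to_rat lookup_sum)

lemma to_rat_cls: "to_rat (cls G a) = qcls G a 1"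
  by (rule poly_mapping_eqI)
    (simp add: lookup_to_rat cls_def qcls_def lookup_single when_def)

lemma sum_single: "(\<Sum>i\<in>A. Poly_Mapping.single c (f i)) = Poly_Mapping.single c (sum f A)"
  by (rule poly_mapping_eqI) (simp add: lookup_sum lookup_single when_def)

section \<open>Pullback to a finite index subgroup\<close>

text \<open>The labelling \<open>pt\<close> stands for the projection to the right cosets of \<open>H\<close>.\<close>

locale coset_action = group G for G (structure) +
  fixes H :: "'a set" and pt :: "'a \<Rightarrow> 'x"
  assumes subgroup_H: "subgroup H G"
    and pt_eq_iff: "\<lbrakk>g \<in> carrier G; h \<in> carrier G\<rbrakk> \<Longrightarrow> pt g = pt h \<longleftrightarrow> g \<otimes> inv h \<in> H"
    and finite_pts: "finite (pt ` carrier G)"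
begin

text \<open>The orbit of the coset \<open>H #> g\<close> under right multiplication by powers of
  \<open>a\<close>, recorded by labels. The base point is a group element because the locale gives
  no action on the labels themselves.\<close>

definition orb :: "'a \<Rightarrow> 'a \<Rightarrow> 'x set" where
  "orb a g = (\<lambda>x. pt (g \<otimes> x)) ` generate G {a}"

lemma orb_eq:
  assumes "a \<in> carrier G"
  shows "orb a g = range (\<lambda>k::int. pt (g \<otimes> a [^] k))"
  using assms by (auto simp: orb_def generate_pow)

text \<open>Right multiplication by \<open>x\<close> leaves \<open>g \<otimes> inv h\<close>
  unchanged, so it descends to labels.\<close>

lemma pt_mult_cong:
  assumes "g \<in> carrier G" "h \<in> carrier G" "x \<in> carrier G" "pt g = pt h"
  shows "pt (g \<otimes> x) = pt (h \<otimes> x)"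
proof -
  have "(g \<otimes> x) \<otimes> inv (h \<otimes> x) = g \<otimes> inv h"
    using assms by (simp add: inv_mult_group m_assoc mult_inv_cancel)
  then show ?thesis
    using assms by (simp add: pt_eq_iff)
qed

lemma orb_subset: "\<lbrakk>a \<in> carrier G; g \<in> carrier G\<rbrakk> \<Longrightarrow> orb a g \<subseteq> pt ` carrier G"
  by (auto simp: orb_eq)

lemma pt_in_orb_self: "\<lbrakk>a \<in> carrier G; g \<in> carrier G\<rbrakk> \<Longrightarrow> pt g \<in> orb a g"
  unfolding orb_eq by (rule range_eqI[of _ _ 0]) simp

text \<open>Moving the base point along the orbit by \<open>a [^] k\<close> only shifts the
  exponents by \<open>k\<close>, which permutes the integers.\<close>

lemma orb_cong:
  assumes "a \<in> carrier G" "g \<in> carrier G" "x \<in> carrier G" "pt x \<in> orb a g"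
  shows "orb a x = orb a g"
proof -
  obtain k :: int where k: "pt x = pt (g \<otimes> a [^] k)"
    using assms by (auto simp: orb_eq)
  have shift: "pt (x \<otimes> a [^] m) = pt (g \<otimes> a [^] (k + m))" for m :: int
    using pt_mult_cong[OF _ _ _ k, of "a [^] m"] assms by (simp add: int_pow_mult m_assoc)
  have "pt (g \<otimes> a [^] m) = pt (x \<otimes> a [^] (m - k))" for m :: int
    by (simp add: shift)
  with shift show ?thesis
    unfolding orb_eq[OF assms(1)] by blast
qed

lemma pt_in_orb_iff:
  "\<lbrakk>a \<in> carrier G; g \<in> carrier G; x \<in> carrier G\<rbrakk> \<Longrightarrow> pt x \<in> orb a g \<longleftrightarrow> orb a x = orb a g"
  using orb_cong[of a g x] pt_in_orb_self[of a x] by auto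

section \<open>Return exponents and orbit sizes\<close>

lemma return_iff:
  assumes "a \<in> carrier G" "g \<in> carrier G"
  shows "g \<otimes> a [^] (k::nat) \<otimes> inv g \<in> H \<longleftrightarrow> pt (g \<otimes> a [^] k) = pt g"
  using assms by (simp add: pt_eq_iff)

lemma pt_pow_eq_iff:
  assumes "a \<in> carrier G" "g \<in> carrier G"
  shows "pt (g \<otimes> a [^] (i::int)) = pt (g \<otimes> a [^] (j::int)) \<longleftrightarrow> pt (g \<otimes> a [^] (i - j)) = pt g"
proof
  assume "pt (g \<otimes> a [^] i) = pt (g \<otimes> a [^] j)"
  from pt_mult_cong[OF _ _ _ this, of "a [^] (-j)"] assms
  show "pt (g \<otimes> a [^] (i - j)) = pt g"
    by (simp add: m_assoc flip: int_pow_mult)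
next
  assume "pt (g \<otimes> a [^] (i - j)) = pt g"
  from pt_mult_cong[OF _ _ _ this, of "a [^] j"] assms
  show "pt (g \<otimes> a [^] i) = pt (g \<otimes> a [^] j)"
    by (simp add: m_assoc flip: int_pow_mult)
qed

text \<open>There are finitely many labels, so two natural powers of \<open>a\<close> give the same
  one; the difference of their exponents is a positive return, and the \<open>LEAST\<close> in
  \<open>return_exp\<close> is attained.\<close>

lemma return_exp:
  assumes a: "a \<in> carrier G" and g: "g \<in> carrier G"
  shows return_exp_pos: "0 < return_exp G H a g"
    and pt_return_exp: "pt (g \<otimes> a [^] return_exp G H a g) = pt g"
    and return_exp_least: "\<lbrakk>0 < k; pt (g \<otimes> a [^] k) = pt g\<rbrakk> \<Longrightarrow> return_exp G H a g \<le> k"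
proof -
  let ?f = "\<lambda>k::nat. pt (g \<otimes> a [^] k)"
  have r: "return_exp G H a g = (LEAST k. 0 < k \<and> ?f k = pt g)"
    unfolding return_exp_def by (simp only: return_iff[OF assms])
  have "finite (range ?f)"
    by (rule finite_subset[OF _ finite_pts]) (use assms in auto)
  then have "\<not> inj ?f"
    using finite_imageD infinite_UNIV_nat by blast
  then obtain i j :: nat where "i < j" "?f j = ?f i"
    unfolding inj_def by (metis linorder_neqE_nat)
  then have "0 < j - i \<and> ?f (j - i) = pt g"
    using pt_pow_eq_iff[OF assms, of "int j" "int i"]
    by (simp add: int_pow_int flip: of_nat_diff)
  then have "0 < return_exp G H a g \<and> ?f (return_exp G H a g) = pt g"
    unfolding r by (rule LeastI)
  then show "0 < return_exp G H a g" "?f (return_exp G H a g) = pt g"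
    by auto
  show "\<lbrakk>0 < k; ?f k = pt g\<rbrakk> \<Longrightarrow> return_exp G H a g \<le> k" for k
    unfolding r by (rule Least_le) simp
qed

text \<open>Every multiple of the return exponent is a period: each step of the induction, upwards
  or downwards, changes the exponent by one return.\<close>

lemma pt_pow_mult_return_exp:
  assumes a: "a \<in> carrier G" and g: "g \<in> carrier G"
  shows "pt (g \<otimes> a [^] (int (return_exp G H a g) * m)) = pt g"
proof (induction m rule: int_induct[where k = 0])
  case base
  show ?case using assms by simp
next
  case (step1 i)
  then show ?case
    using pt_pow_eq_iff[OF assms, of "int (return_exp G H a g) * (i + 1)" "int (return_exp G H a g)"]
      pt_return_exp[OF assms] assms
    by (simp add: algebra_simps int_pow_int)
next
  case (step2 i)
  then show ?case
    using pt_pow_eq_iff[OF assms, of "int (return_exp G H a g) * i" "int (return_exp G H a g)"]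
      pt_return_exp[OF assms] assms
    by (simp add: algebra_simps int_pow_int)
qed

text \<open>The exponents below the return exponent give distinct labels by minimality, and they
  exhaust the orbit since any integer exponent may be reduced modulo it.\<close>

lemma card_orb:
  assumes a: "a \<in> carrier G" and g: "g \<in> carrier G"
  shows "card (orb a g) = return_exp G H a g"
proof -
  let ?r = "return_exp G H a g" and ?f = "\<lambda>k::nat. pt (g \<otimes> a [^] k)"
  have lt: "i = j" if "i \<le> j" "j < ?r" "?f i = ?f j" for i j
  proof (rule ccontr)
    assume "i \<noteq> j"
    then have "0 < j - i" using that by simp
    moreover have "?f (j - i) = pt g"
      using pt_pow_eq_iff[OF assms, of "int j" "int i"] that
      by (simp add: int_pow_int flip: of_nat_diff)
    ultimately have "?r \<le> j - i"
      by (rule return_exp_least[OF assms])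
    then show False using that by simp
  qed
  have "inj_on ?f {..<?r}"
  proof (rule linorder_inj_onI')
    show "?f i \<noteq> ?f j" if "i < j" "j \<in> {..<?r}" for i j
      using lt[of i j] that by auto
  qed
  moreover have "?f ` {..<?r} \<subseteq> orb a g"
    using a by (auto simp: orb_eq simp flip: int_pow_int)
  moreover have "orb a g \<subseteq> ?f ` {..<?r}"
  proof
    fix x assume "x \<in> orb a g"
    then obtain k :: int where k: "x = pt (g \<otimes> a [^] k)"
      using a by (auto simp: orb_eq)
    define m where "m = nat (k mod int ?r)"
    have m: "int m = k mod int ?r" "m < ?r"
      using return_exp_pos[OF assms] by (auto simp: m_def nat_less_iff)
    have "k - int m = int ?r * (k div int ?r)"
      by (simp add: m minus_mod_eq_mult_div)
    then have "x = ?f m"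
      using pt_pow_eq_iff[OF assms, of k "int m"] pt_pow_mult_return_exp[OF assms] k
      by (simp add: int_pow_int)
    then show "x \<in> ?f ` {..<?r}" using m by blast
  qed
  ultimately show ?thesis
    using card_image[of ?f "{..<?r}"] by simp
qed

lemma conj_return_in:
  "\<lbrakk>a \<in> carrier G; g \<in> carrier G\<rbrakk> \<Longrightarrow> g \<otimes> a [^] return_exp G H a g \<otimes> inv g \<in> H"
  by (simp add: return_iff pt_return_exp)

lemma return_exp_cong:
  "\<lbrakk>a \<in> carrier G; g \<in> carrier G; x \<in> carrier G; pt x \<in> orb a g\<rbrakk>
    \<Longrightarrow> return_exp G H a x = return_exp G H a g"
  using orb_cong[of a g x] by (simp flip: card_orb)

lemma group_H: "group (G\<lparr>carrier := H\<rparr>)"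
  by (rule subgroup.subgroup_is_group[OF subgroup_H is_group])

text \<open>Write \<open>x = h \<otimes> (g \<otimes> c)\<close> with \<open>h\<close> in
  \<open>H\<close> and \<open>c\<close> a power of \<open>a\<close>. Since \<open>c\<close> commutes
  with the power \<open>b\<close> of \<open>a\<close>, it drops out of
  \<open>x \<otimes> b \<otimes> inv x\<close>, and only conjugation by \<open>h\<close>
  remains.\<close>

lemma conj_class_return_cong:
  assumes a: "a \<in> carrier G" and g: "g \<in> carrier G" and x: "x \<in> carrier G" and "pt x \<in> orb a g"
  shows "conj_class (G\<lparr>carrier := H\<rparr>) (x \<otimes> a [^] return_exp G H a x \<otimes> inv x) =
         conj_class (G\<lparr>carrier := H\<rparr>) (g \<otimes> a [^] return_exp G H a g \<otimes> inv g)"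
proof -
  interpret H: group "G\<lparr>carrier := H\<rparr>" by (rule group_H)
  define b where "b = a [^] return_exp G H a g"
  obtain k :: int where "pt x = pt (g \<otimes> a [^] k)"
    using assms by (auto simp: orb_eq)
  define c where "c = a [^] k"
  define h where "h = x \<otimes> inv (g \<otimes> c)"
  have carr: "b \<in> carrier G" "c \<in> carrier G"
    using a by (simp_all add: b_def c_def)
  have "h \<in> H"
    using \<open>pt x = _\<close> assms by (simp add: h_def c_def pt_eq_iff)
  then have h: "h \<in> carrier G" using subgroup.mem_carrier[OF subgroup_H] by blast
  have "x = h \<otimes> (g \<otimes> c)"
    using x g carr by (simp add: h_def m_assoc)
  have "c \<otimes> b \<otimes> inv c = b"
  proof -
    have "c \<otimes> b = b \<otimes> c"
      unfolding b_def c_def using a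
      by (simp add: int_pow_mult[symmetric] add.commute flip: int_pow_int)
    then show ?thesis using carr by (simp add: m_assoc)
  qed
  moreover have "x \<otimes> b \<otimes> inv x = h \<otimes> (g \<otimes> (c \<otimes> b \<otimes> inv c) \<otimes> inv g) \<otimes> inv h"
    unfolding \<open>x = _\<close> using h g carr by (simp add: inv_mult_group m_assoc)
  ultimately have "x \<otimes> b \<otimes> inv x = h \<otimes> (g \<otimes> b \<otimes> inv g) \<otimes> inv h"
    by simp
  \<comment> \<open>Inverses in \<open>H\<close> agree with those in \<open>G\<close>, so the
    conjugation by \<open>h\<close> takes place inside the subgroup.\<close>
  also have "\<dots> = h \<otimes>\<^bsub>G\<lparr>carrier := H\<rparr>\<^esub> (g \<otimes> b \<otimes> inv g) \<otimes>\<^bsub>G\<lparr>carrier := H\<rparr>\<^esub> inv\<^bsub>G\<lparr>carrier := H\<rparr>\<^esub> h"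
    using \<open>h \<in> H\<close> by (simp add: m_inv_consistent[OF subgroup_H])
  finally show ?thesis
    using H.conj_class_eq[of "g \<otimes> b \<otimes> inv g" h] \<open>h \<in> H\<close> conj_return_in[OF a g]
    by (simp add: return_exp_cong[OF assms] b_def)
qed

text \<open>Double cosets are the preimages of orbits under \<open>pt\<close>: both sides say that
  \<open>x \<otimes> inv (g \<otimes> a [^] k)\<close> lies in \<open>H\<close> for some integer
  \<open>k\<close>.\<close>

lemma double_coset_eq:
  assumes a: "a \<in> carrier G" and g: "g \<in> carrier G"
  shows "(H #> g) <#> generate G {a} = {x \<in> carrier G. pt x \<in> orb a g}"
proof (intro Set.set_eqI iffI)
  fix x assume "x \<in> (H #> g) <#> generate G {a}"
  then obtain h k where h: "h \<in> H" "x = h \<otimes> g \<otimes> a [^] (k::int)"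
    using a by (auto simp: set_mult_def r_coset_def generate_pow)
  have hc: "h \<in> carrier G" using h subgroup.mem_carrier[OF subgroup_H] by blast
  have "x \<otimes> inv (g \<otimes> a [^] k) = h"
    using h hc a g by (simp add: m_assoc inv_mult_group mult_inv_cancel)
  moreover have x: "x \<in> carrier G"
    using h hc a g by simp
  ultimately have "pt x = pt (g \<otimes> a [^] k)"
    using h a g by (simp add: pt_eq_iff)
  then show "x \<in> {x \<in> carrier G. pt x \<in> orb a g}"
    using x a by (auto simp: orb_eq)
next
  fix x assume "x \<in> {x \<in> carrier G. pt x \<in> orb a g}"
  then obtain k :: int where x: "x \<in> carrier G" "pt x = pt (g \<otimes> a [^] k)"
    using a by (auto simp: orb_eq)
  then have "x \<otimes> inv (g \<otimes> a [^] k) \<in> H"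
    using a g by (simp add: pt_eq_iff)
  moreover have "x = (x \<otimes> inv (g \<otimes> a [^] k)) \<otimes> g \<otimes> a [^] k"
    using x a g by (simp add: m_assoc)
  moreover have "a [^] k \<in> generate G {a}"
    using a by (auto simp: generate_pow)
  ultimately show "x \<in> (H #> g) <#> generate G {a}"
    unfolding set_mult_def r_coset_def by blast
qed

section \<open>Replacing an element by a conjugate\<close>

lemma conj_pow:
  assumes "a \<in> carrier G" "h \<in> carrier G"
  shows "(h \<otimes> a \<otimes> inv h) [^] (k::nat) = h \<otimes> a [^] k \<otimes> inv h"
  using assms by (induction k) (simp_all add: m_assoc mult_inv_cancel)

lemma conj_int_pow:
  assumes "a \<in> carrier G" "h \<in> carrier G"
  shows "(h \<otimes> a \<otimes> inv h) [^] (k::int) = h \<otimes> a [^] k \<otimes> inv h"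
proof (cases k)
  case (nonneg n)
  then show ?thesis using assms by (simp only: int_pow_int conj_pow)
next
  case (neg n)
  have "(h \<otimes> a \<otimes> inv h) [^] k = inv (h \<otimes> a [^] Suc n \<otimes> inv h)"
    using assms by (simp only: neg int_pow_neg int_pow_int conj_pow m_closed inv_closed)
  also have "\<dots> = h \<otimes> inv (a [^] Suc n) \<otimes> inv h"
    using assms by (simp add: inv_mult_group m_assoc del: nat_pow_Suc)
  finally show ?thesis
    using assms by (simp only: neg int_pow_neg int_pow_int)
qed

text \<open>Right translation by \<open>h\<close> turns orbits of the conjugate into orbits of
  \<open>a\<close>.\<close>

lemma orb_conj:
  assumes "a \<in> carrier G" "h \<in> carrier G" "g \<in> carrier G" "x \<in> carrier G"
  shows "pt x \<in> orb (h \<otimes> a \<otimes> inv h) g \<longleftrightarrow> pt (x \<otimes> h) \<in> orb a (g \<otimes> h)"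
proof -
  have "pt x = pt (g \<otimes> (h \<otimes> a \<otimes> inv h) [^] k) \<longleftrightarrow> pt (x \<otimes> h) = pt ((g \<otimes> h) \<otimes> a [^] k)" for k :: int
    unfolding conj_int_pow[OF assms(1,2)]
    using assms by (simp add: pt_eq_iff inv_mult_group m_assoc)
  then show ?thesis
    using assms by (auto simp: orb_eq)
qed

text \<open>The two conjugates agree for every exponent, so the predicates under
  \<open>LEAST\<close> coincide and the return exponents are equal.\<close>

lemma conj_return_conj:
  assumes "a \<in> carrier G" "h \<in> carrier G" "g \<in> carrier G"
  defines "b \<equiv> h \<otimes> a \<otimes> inv h"
  shows "g \<otimes> b [^] return_exp G H b g \<otimes> inv g =
         (g \<otimes> h) \<otimes> a [^] return_exp G H a (g \<otimes> h) \<otimes> inv (g \<otimes> h)"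
proof -
  have *: "g \<otimes> b [^] (k::nat) \<otimes> inv g = (g \<otimes> h) \<otimes> a [^] k \<otimes> inv (g \<otimes> h)" for k
    unfolding b_def conj_pow[OF assms(1,2)]
    using assms by (simp add: inv_mult_group m_assoc)
  show ?thesis
    unfolding return_exp_def * ..
qed

text \<open>Frees the pullback from its choices: \<open>pull\<close> works with an unknown conjugate
  \<open>b\<close> of \<open>a\<close> and unknown double coset representatives, while the
  right-hand side uses \<open>a\<close> itself and any family meeting each orbit once.\<close>

theorem pull_cls:
  fixes \<gamma> :: "'i \<Rightarrow> 'a"
  assumes a: "a \<in> carrier G"
    and \<gamma>: "\<And>k. k \<in> S \<Longrightarrow> \<gamma> k \<in> carrier G"
    and reps: "\<And>x. x \<in> carrier G \<Longrightarrow> \<exists>!k. k \<in> S \<and> pt x \<in> orb a (\<gamma> k)"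
  shows "pull G H (cls G a) = (\<Sum>k\<in>S. cls (G\<lparr>carrier := H\<rparr>)
           (\<gamma> k \<otimes> a [^] return_exp G H a (\<gamma> k) \<otimes> inv (\<gamma> k)))"
proof -
  obtain h where h: "h \<in> carrier G" "(SOME x. x \<in> conj_class G a) = h \<otimes> a \<otimes> inv h"
    using some_in_conj_class a by blast
  define b where "b = h \<otimes> a \<otimes> inv h"
  have b: "b \<in> carrier G" using a h by (simp add: b_def)
  \<comment> \<open>The double coset of \<open>b\<close> that belongs to index \<open>k\<close>: the
    double coset of \<open>\<gamma> k\<close> for \<open>a\<close>, translated by
    \<open>inv h\<close>.\<close>
  define D where "D k = {x \<in> carrier G. pt (x \<otimes> h) \<in> orb a (\<gamma> k)}" for k
  define F where "F s = (let g = (SOME g. g \<in> s) in cls (G\<lparr>carrier := H\<rparr>)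
         (g \<otimes> b [^] return_exp G H b g \<otimes> inv g))" for s
  have ex: "\<gamma> k \<otimes> inv h \<in> D k" if "k \<in> S" for k
    using that a \<gamma> h by (simp add: D_def m_assoc pt_in_orb_self)
  have dc: "(H #> g) <#> generate G {b} = {x \<in> carrier G. pt (x \<otimes> h) \<in> orb a (g \<otimes> h)}"
    if "g \<in> carrier G" for g
    using orb_conj[of a h g] that a h b by (auto simp: double_coset_eq b_def)
  have "bij_betw D S (double_cosets G H b)"
    unfolding bij_betw_def
  proof (intro conjI inj_onI equalityI subsetI)
    fix k l assume kl: "k \<in> S" "l \<in> S" "D k = D l"
    then have "\<gamma> k \<otimes> inv h \<in> D k" "\<gamma> k \<otimes> inv h \<in> D l"
      using ex by auto
    then show "k = l"
      using reps[of "\<gamma> k"] kl \<gamma> h by (auto simp: D_def m_assoc)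
  next
    fix s assume "s \<in> D ` S"
    then obtain k where k: "k \<in> S" "s = D k" by blast
    have "D k = (H #> (\<gamma> k \<otimes> inv h)) <#> generate G {b}"
      using k \<gamma> h by (simp add: dc D_def m_assoc)
    then show "s \<in> double_cosets G H b"
      unfolding double_cosets_def using k \<gamma> h by blast
  next
    fix s assume "s \<in> double_cosets G H b"
    then obtain g where g: "g \<in> carrier G" "s = (H #> g) <#> generate G {b}"
      by (auto simp: double_cosets_def)
    obtain k where k: "k \<in> S" "pt (g \<otimes> h) \<in> orb a (\<gamma> k)"
      using reps[of "g \<otimes> h"] g h by auto
    then have "s = D k"
      using g h a \<gamma> orb_cong[of a "\<gamma> k" "g \<otimes> h"] by (simp add: D_def dc)
    then show "s \<in> D ` S" using k by blast
  qed
  then have "(\<Sum>s\<in>double_cosets G H b. F s) = (\<Sum>k\<in>S. F (D k))"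
    by (rule sum.reindex_bij_betw[symmetric])
  also have "\<dots> = (\<Sum>k\<in>S. cls (G\<lparr>carrier := H\<rparr>)
           (\<gamma> k \<otimes> a [^] return_exp G H a (\<gamma> k) \<otimes> inv (\<gamma> k)))"
  proof (rule sum.cong[OF refl])
    fix k assume k: "k \<in> S"
    \<comment> \<open>The representative that \<open>pull\<close> selects; after translation by
      \<open>h\<close> its label lies in the orbit of \<open>\<gamma> k\<close>, so it yields the
      same class.\<close>
    define g where "g = (SOME g. g \<in> D k)"
    have "g \<in> D k"
      unfolding g_def using ex[OF k] by (rule someI)
    then have g: "g \<in> carrier G" "pt (g \<otimes> h) \<in> orb a (\<gamma> k)"
      by (auto simp: D_def)
    show "F (D k) = cls (G\<lparr>carrier := H\<rparr>) (\<gamma> k \<otimes> a [^] return_exp G H a (\<gamma> k) \<otimes> inv (\<gamma> k))"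
      unfolding F_def Let_def g_def[symmetric] cls_def b_def conj_return_conj[OF a h(1) g(1)]
      using conj_class_return_cong[OF a \<gamma>[OF k] _ g(2)] g h by simp
  qed
  finally show ?thesis
    unfolding pull_def cls_def F_def b_def by (simp add: h Let_def cls_def)
qed

text \<open>The index set splits into blocks, one per orbit. On a block \<open>F\<close> is constant
  and every coefficient is the reciprocal of the orbit size, so the block contributes coefficient
  1.\<close>

lemma sum_orbit_average:
  fixes \<gamma> :: "'i \<Rightarrow> 'a" and F :: "'i \<Rightarrow> 'c"
  assumes a: "a \<in> carrier G" and "S \<subseteq> I"
    and \<gamma>: "\<And>k. k \<in> I \<Longrightarrow> \<gamma> k \<in> carrier G"
    and bij: "bij_betw (\<lambda>j. pt (\<gamma> j)) I (pt ` carrier G)"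
    and reps: "\<And>x. x \<in> carrier G \<Longrightarrow> \<exists>!k. k \<in> S \<and> pt x \<in> orb a (\<gamma> k)"
    and F: "\<And>j k. \<lbrakk>j \<in> I; k \<in> I; pt (\<gamma> j) \<in> orb a (\<gamma> k)\<rbrakk> \<Longrightarrow> F j = F k"
  shows "(\<Sum>k\<in>S. Poly_Mapping.single (F k) (1::rat)) =
         (\<Sum>j\<in>I. Poly_Mapping.single (F j) (1 / of_nat (return_exp G H a (\<gamma> j))))"
proof -
  have finI: "finite I"
    using bij finite_pts bij_betw_finite by blast
  have finS: "finite S"
    using finI \<open>S \<subseteq> I\<close> finite_subset by blast
  let ?t = "\<lambda>j. Poly_Mapping.single (F j) (1 / rat_of_nat (return_exp G H a (\<gamma> j)))"
  define A where "A k = {j \<in> I. pt (\<gamma> j) \<in> orb a (\<gamma> k)}" for k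
  have I: "I = (\<Union>k\<in>S. A k)"
  proof (intro equalityI subsetI)
    fix j assume "j \<in> I"
    then show "j \<in> (\<Union>k\<in>S. A k)"
      using ex1_implies_ex[OF reps[OF \<gamma>]] by (auto simp: A_def)
  qed (auto simp: A_def)
  have disj: "A k \<inter> A l = {}" if "k \<in> S" "l \<in> S" "k \<noteq> l" for k l
  proof -
    have "k = l" if "j \<in> A k" "j \<in> A l" for j
      using that reps[OF \<gamma>, of j] \<open>k \<in> S\<close> \<open>l \<in> S\<close> by (auto simp: A_def)
    then show ?thesis using \<open>k \<noteq> l\<close> by blast
  qed
  have "(\<Sum>j\<in>I. ?t j) = (\<Sum>k\<in>S. \<Sum>j\<in>A k. ?t j)"
  proof (subst I, rule sum.UNION_disjoint)
    show "\<forall>k\<in>S. finite (A k)"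
      using finI by (simp add: A_def)
    show "\<forall>k\<in>S. \<forall>l\<in>S. k \<noteq> l \<longrightarrow> A k \<inter> A l = {}"
      using disj by blast
  qed (rule finS)
  also have "\<dots> = (\<Sum>k\<in>S. Poly_Mapping.single (F k) 1)"
  proof (rule sum.cong[OF refl])
    fix k assume "k \<in> S"
    then have k: "k \<in> I" "\<gamma> k \<in> carrier G" using \<open>S \<subseteq> I\<close> \<gamma> by auto
    let ?r = "return_exp G H a (\<gamma> k)"
    \<comment> \<open>Every label is hit exactly once by \<open>I\<close>, so the block
      \<open>A k\<close> has as many indices as the orbit has points.\<close>
    have "(\<lambda>j. pt (\<gamma> j)) ` A k = orb a (\<gamma> k)"
    proof (intro equalityI subsetI)
      fix x assume x: "x \<in> orb a (\<gamma> k)"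
      then have "x \<in> (\<lambda>j. pt (\<gamma> j)) ` I"
        using bij_betw_imp_surj_on[OF bij] orb_subset[OF a k(2)] by auto
      then show "x \<in> (\<lambda>j. pt (\<gamma> j)) ` A k"
        using x by (auto simp: A_def)
    qed (auto simp: A_def)
    moreover have "inj_on (\<lambda>j. pt (\<gamma> j)) (A k)"
      using bij_betw_imp_inj_on[OF bij] by (rule inj_on_subset) (auto simp: A_def)
    ultimately have card: "card (A k) = ?r"
      by (metis card_image card_orb[OF a k(2)])
    have "(\<Sum>j\<in>A k. ?t j) = (\<Sum>j\<in>A k. Poly_Mapping.single (F k) (1 / rat_of_nat ?r))"
    proof (rule sum.cong[OF refl])
      fix j assume "j \<in> A k"
      then have j: "j \<in> I" "pt (\<gamma> j) \<in> orb a (\<gamma> k)" by (auto simp: A_def)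
      show "?t j = Poly_Mapping.single (F k) (1 / rat_of_nat ?r)"
        by (simp add: F[OF j(1) k(1) j(2)] return_exp_cong[OF a k(2) \<gamma>[OF j(1)] j(2)])
    qed
    also have "\<dots> = Poly_Mapping.single (F k) 1"
      using return_exp_pos[OF a k(2)] by (simp add: sum_single card)
    finally show "(\<Sum>j\<in>A k. ?t j) = Poly_Mapping.single (F k) 1" .
  qed
  finally show ?thesis ..
qed

end

section \<open>The projective line as a coset space of the modular group\<close>

lemma mat2_eq_iff:
  fixes A B :: "'a^2^2"
  shows "A = B \<longleftrightarrow> A$1$1 = B$1$1 \<and> A$1$2 = B$1$2 \<and> A$2$1 = B$2$1 \<and> A$2$2 = B$2$2"
  by (auto simp: vec_eq_iff forall_2)

lemma mat2_mult_nth: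
  fixes A B :: "'a::semiring_1^2^2"
  shows "(A ** B)$i$j = A$i$1 * B$1$j + A$i$2 * B$2$j"
  by (simp add: matrix_matrix_mult_def sum_2)

lemma mat2_one_nth:
  "(mat 1 :: 'a::semiring_1^2^2)$1$1 = 1" "(mat 1 :: 'a::semiring_1^2^2)$1$2 = 0"
  "(mat 1 :: 'a::semiring_1^2^2)$2$1 = 0" "(mat 1 :: 'a::semiring_1^2^2)$2$2 = 1"
  by (simp_all add: mat_def)

lemma SL2Z_simps [simp]:
  "A \<in> carrier SL2Z \<longleftrightarrow> det A = 1" "A \<otimes>\<^bsub>SL2Z\<^esub> B = A ** B" "\<one>\<^bsub>SL2Z\<^esub> = mat 1"
  by (simp_all add: SL2Z_def)

lemma adjugate_mult:
  fixes A :: "int^2^2"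
  assumes "det A = 1"
  shows "vector [vector [A$2$2, - A$1$2], vector [- A$2$1, A$1$1]] ** A = mat 1"
  using assms by (auto simp: mat2_eq_iff mat2_mult_nth mat2_one_nth det_2 algebra_simps)

lemma group_SL2Z: "group SL2Z"
proof (rule groupI)
  fix A assume A: "A \<in> carrier SL2Z"
  let ?B = "vector [vector [A$2$2, - A$1$2], vector [- A$2$1, A$1$1]] :: int^2^2"
  have "det ?B = 1" using A by (simp add: det_2 algebra_simps)
  then show "\<exists>B\<in>carrier SL2Z. B \<otimes>\<^bsub>SL2Z\<^esub> A = \<one>\<^bsub>SL2Z\<^esub>"
    using adjugate_mult[of A] A by (intro bexI[of _ ?B]) auto
qed (auto simp: det_mul matrix_mul_assoc)

text \<open>The adjugate is spelled out so that the lower left entry of \<open>A ** inv B\<close>,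
  which decides membership in \<open>Gamma0 p\<close>, can be read off.\<close>

lemma inv_SL2Z:
  assumes "det A = 1"
  shows "inv\<^bsub>SL2Z\<^esub> A = vector [vector [A$2$2, - A$1$2], vector [- A$2$1, A$1$1]]"
  using assms adjugate_mult[of A]
  by (intro group.inv_equality[OF group_SL2Z]) (auto simp: det_2 algebra_simps)

lemma in_Gamma0_iff: "A \<in> Gamma0 p \<longleftrightarrow> det A = 1 \<and> int p dvd A$2$1"
  by (simp add: Gamma0_def)

lemma subgroup_Gamma0: "subgroup (Gamma0 p) SL2Z"
proof (rule group.subgroupI[OF group_SL2Z])
  show "Gamma0 p \<noteq> {}"
    using in_Gamma0_iff[of "mat 1" p] by (auto simp: mat2_one_nth)
  show "inv\<^bsub>SL2Z\<^esub> A \<in> Gamma0 p" if "A \<in> Gamma0 p" for A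
    using that by (auto simp: in_Gamma0_iff inv_SL2Z det_2 algebra_simps)
  show "A \<otimes>\<^bsub>SL2Z\<^esub> B \<in> Gamma0 p" if "A \<in> Gamma0 p" "B \<in> Gamma0 p" for A B
    using that by (simp add: in_Gamma0_iff det_mul mat2_mult_nth)
qed (auto simp: in_Gamma0_iff)

section \<open>Points of the projective line in homogeneous coordinates\<close>

lemma red_eq_iff:
  "red p v = red p w \<longleftrightarrow> int p dvd v$1 - w$1 \<and> int p dvd v$2 - w$2"
  by (simp add: red_def vec_eq_iff forall_2 mod_eq_dvd_iff)

lemma red_eq_0_iff: "red p v = 0 \<longleftrightarrow> int p dvd v$1 \<and> int p dvd v$2"
  by (simp add: red_def vec_eq_iff forall_2 dvd_eq_mod_eq_0)

lemma vector_mult_mat2_nth: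
  fixes v :: "int^2" and A :: "int^2^2"
  shows "(v v* A)$j = v$1 * A$1$j + v$2 * A$2$j"
  by (simp add: vector_matrix_mult_def sum_2 mult.commute)

lemma red_mult_red: "red p (red p v v* A) = red p (v v* A)"
  by (simp add: red_def vec_eq_iff vector_mult_mat2_nth)
    (auto intro!: mod_add_cong mod_mult_cong)

text \<open>Scaling commutes with right multiplication and reduction can be postponed, so the action
  can be computed on any homogeneous coordinates.\<close>

lemma P1_act_point: "P1_act p (P1_point p v) A = P1_point p (v v* A)"
proof -
  have "(l *s v) v* A = l *s (v v* A)" for l
    by (simp add: vec_eq_iff vector_mult_mat2_nth algebra_simps)
  moreover have "P1_point p w = (\<lambda>l. red p (l *s w)) ` {l. \<not> int p dvd l}" for w
    by (auto simp: P1_point_def)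
  ultimately show ?thesis
    by (simp add: P1_act_def image_image red_mult_red)
qed

lemma base_translate_eq: "base_translate p j = P1_point p (gamma_mat j $ 2)"
proof -
  have "vector [0, 1] v* gamma_mat j = gamma_mat j $ 2"
    by (simp add: vec_eq_iff vector_mult_mat2_nth)
  then show ?thesis by (simp add: base_translate_def P1_act_point)
qed

text \<open>Bezout gives an inverse \<open>u\<close> of \<open>w1\<close> modulo \<open>p\<close>;
  the scalar \<open>u * v1\<close> matches the first coordinates, and the cross product condition
  then matches the second.\<close>

lemma multiple_mod_prime:
  assumes "prime p" "\<not> int p dvd w1" "int p dvd v1 * w2 - v2 * w1"
  obtains l where "int p dvd v1 - l * w1" "int p dvd v2 - l * w2"
proof -
  have "coprime (int p) w1"
    using assms by (intro prime_imp_coprime) auto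
  then obtain t u where tu: "t * int p + u * w1 = 1"
    using bezout_int[of "int p" w1] by (auto simp: coprime_iff_gcd_eq_1)
  have "v1 - u * v1 * w1 = v1 * (t * int p + u * w1) - u * v1 * w1" by (simp add: tu)
  then have 1: "v1 - u * v1 * w1 = int p * (v1 * t)" by (simp add: algebra_simps)
  have "v2 - u * v1 * w2 = v2 * (t * int p + u * w1) - u * v1 * w2" by (simp add: tu)
  then have 2: "v2 - u * v1 * w2 = int p * (v2 * t) - u * (v1 * w2 - v2 * w1)"
    by (simp add: algebra_simps)
  show ?thesis
    by (rule that[of "u * v1"]) (use assms(3) in \<open>auto simp: 1 2\<close>)
qed

lemma P1_point_subset:
  assumes p: "prime p" and "red p v \<noteq> 0" "red p w \<noteq> 0"
    and cross: "int p dvd v$1 * w$2 - v$2 * w$1"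
  shows "P1_point p v \<subseteq> P1_point p w"
proof -
  obtain l where l: "int p dvd v$1 - l * w$1" "int p dvd v$2 - l * w$2"
  proof (cases "int p dvd w$1")
    case False
    then show ?thesis using multiple_mod_prime[OF p False cross] that by blast
  next
    case True
    \<comment> \<open>The first coordinate vanishes modulo \<open>p\<close>, so the second is a unit
      and the same argument runs with coordinates swapped.\<close>
    then have *: "\<not> int p dvd w$2" using assms by (auto simp: red_eq_0_iff)
    have "int p dvd v$2 * w$1 - v$1 * w$2"
      using cross by (simp add: dvd_diff_commute)
    then show ?thesis using multiple_mod_prime[OF p *] that by blast
  qed
  \<comment> \<open>A scalar divisible by \<open>p\<close> would make \<open>v\<close> reduce to
    zero.\<close>
  have nl: "\<not> int p dvd l"
  proof
    assume "int p dvd l"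
    then have "int p dvd (v$1 - l * w$1) + l * w$1" "int p dvd (v$2 - l * w$2) + l * w$2"
      using l by (blast intro: dvd_add dvd_mult2)+
    then show False using assms by (simp add: red_eq_0_iff)
  qed
  show ?thesis
  proof
    fix x assume "x \<in> P1_point p v"
    then obtain k where k: "x = red p (k *s v)" "\<not> int p dvd k"
      by (auto simp: P1_point_def)
    have "int p dvd k * v$1 - (k * l) * w$1" "int p dvd k * v$2 - (k * l) * w$2"
      using dvd_mult[OF l(1), of k] dvd_mult[OF l(2), of k] by (simp_all add: algebra_simps)
    then have "x = red p ((k * l) *s w)"
      by (simp add: k red_eq_iff)
    moreover have "\<not> int p dvd k * l"
      using k nl p by (simp add: prime_dvd_mult_iff)
    ultimately show "x \<in> P1_point p w"
      by (auto simp: P1_point_def)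
  qed
qed

text \<open>Proportionality modulo \<open>p\<close> is tested by the two by two determinant, the
  form in which cosets of \<open>Gamma0 p\<close> produce it.\<close>

lemma P1_point_eq_iff:
  assumes p: "prime p" and "red p v \<noteq> 0" "red p w \<noteq> 0"
  shows "P1_point p v = P1_point p w \<longleftrightarrow> int p dvd v$1 * w$2 - v$2 * w$1"
proof
  assume "P1_point p v = P1_point p w"
  moreover have "red p (1 *s v) \<in> P1_point p v"
    using p unfolding P1_point_def by (intro CollectI exI[of _ 1]) (auto dest: not_prime_unit)
  ultimately obtain l where "red p (1 *s v) = red p (l *s w)"
    by (auto simp: P1_point_def)
  then have l: "int p dvd v$1 - l * w$1" "int p dvd v$2 - l * w$2"
    by (simp_all add: red_eq_iff)
  have "v$1 * w$2 - v$2 * w$1 = (v$1 - l * w$1) * w$2 - (v$2 - l * w$2) * w$1"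
    by (simp add: algebra_simps)
  then show "int p dvd v$1 * w$2 - v$2 * w$1"
    using dvd_diff[OF dvd_mult2[OF l(1)] dvd_mult2[OF l(2)]] by (simp only:)
next
  assume "int p dvd v$1 * w$2 - v$2 * w$1"
  moreover from this have "int p dvd w$1 * v$2 - w$2 * v$1"
    by (subst dvd_diff_commute) (simp add: mult.commute)
  ultimately show "P1_point p v = P1_point p w"
    using assms by (intro equalityI P1_point_subset)
qed

section \<open>Bottom rows and right cosets of \<open>Gamma0 p\<close>\<close>

lemma red_row_nonzero:
  assumes "prime p" "det A = 1"
  shows "red p (A$2) \<noteq> 0"
proof
  assume "red p (A$2) = 0"
  then have "int p dvd det A" by (auto simp: red_eq_0_iff det_2)
  then show False using assms by (auto dest: not_prime_unit)
qed

lemma det_gamma_mat: "det (gamma_mat j) = 1"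
  by (simp add: gamma_mat_def det_2 mat2_one_nth)

lemma gamma_mat_row: "gamma_mat j $ 2 = (if j = 0 then vector [0, 1] else vector [1, int j])"
  by (simp add: gamma_mat_def vec_eq_iff forall_2 mat2_one_nth)

text \<open>Index 0 gives the point [0,1] and \<open>j\<close> from 1 to \<open>p\<close> gives
  [1,j], with \<open>j = p\<close> standing for the residue 0.\<close>

lemma bij_base_translate:
  assumes p: "prime p"
  shows "bij_betw (base_translate p) {0..p} ((\<lambda>A. P1_point p (A$2)) ` carrier SL2Z)"
  unfolding bij_betw_def
proof (intro conjI equalityI subsetI)
  have not_dvd_1: "\<not> int p dvd 1" using p by (auto dest: not_prime_unit)
  have nz: "red p (gamma_mat j $ 2) \<noteq> 0" for j
    using red_row_nonzero[OF p] by (simp add: det_gamma_mat)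
  show "inj_on (base_translate p) {0..p}"
  proof (rule linorder_inj_onI')
    fix i j assume ij: "j \<in> {0..p}" "i < j"
    show "base_translate p i \<noteq> base_translate p j"
    proof (cases "i = 0")
      case True
      then show ?thesis
        using ij not_dvd_1 nz[of i] nz[of j] by (simp add: base_translate_eq P1_point_eq_iff[OF p] gamma_mat_row)
    next
      case False
      \<comment> \<open>Both indices lie between 1 and \<open>p\<close>, so the difference is
        positive and less than \<open>p\<close>.\<close>
      have "\<not> int p dvd int j - int i"
        using ij False zdvd_not_zless[of "int j - int i" "int p"] by simp
      then show ?thesis
        using False ij nz[of i] nz[of j] by (simp add: base_translate_eq P1_point_eq_iff[OF p] gamma_mat_row)
    qed
  qed
  show "x \<in> (\<lambda>A. P1_point p (A$2)) ` carrier SL2Z" if "x \<in> base_translate p ` {0..p}" for x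
    using that by (auto simp: base_translate_eq det_gamma_mat)
  fix x assume "x \<in> (\<lambda>A. P1_point p (A$2)) ` carrier SL2Z"
  then obtain A where A: "det A = 1" "x = P1_point p (A$2)" by auto
  note nzA = red_row_nonzero[OF p A(1)]
  show "x \<in> base_translate p ` {0..p}"
  proof (cases "int p dvd A$2$1")
    case True
    then have "x = base_translate p 0"
      using nz[of 0] nzA by (simp add: A base_translate_eq P1_point_eq_iff[OF p] gamma_mat_row)
    then show ?thesis by auto
  next
    case False
    have p0: "p > 0" using p by (simp add: prime_gt_0_nat)
    \<comment> \<open>An inverse of the lower left entry modulo \<open>p\<close>, used to scale the
      first coordinate to 1.\<close>
    obtain l where l: "int p dvd 1 - l * A$2$1"
      using multiple_mod_prime[OF p False, of 1 0 0] by auto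
    \<comment> \<open>Subtracting 1 before the reduction and adding it afterwards puts
      \<open>j\<close> in the range from 1 to \<open>p\<close>, because index 0 is taken by
      [0,1].\<close>
    define j where "j = nat ((l * A$2$2 - 1) mod int p) + 1"
    have j: "j \<in> {0..p}" "j \<noteq> 0"
      using p0 by (auto simp: j_def nat_less_iff Suc_le_eq)
    have "int j = (l * A$2$2 - 1) mod int p + 1"
      using p0 by (simp add: j_def)
    then have "int p dvd l * A$2$2 - int j"
      using dvd_minus_mod[of "int p" "l * A$2$2 - 1"] by (simp add: algebra_simps)
    \<comment> \<open>The terms containing \<open>l\<close> cancel in this combination, leaving the
      determinant that compares the bottom row of \<open>A\<close> with (1,j).\<close>
    then have "int p dvd A$2$2 * (1 - l * A$2$1) + A$2$1 * (l * A$2$2 - int j)"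
      using l by simp
    then have "int p dvd A$2$2 - A$2$1 * int j"
      by (simp add: algebra_simps)
    then have "x = base_translate p j"
      using nz[of j] nzA j by (simp add: A base_translate_eq P1_point_eq_iff[OF p] gamma_mat_row dvd_diff_commute)
    then show ?thesis using j by blast
  qed
qed

text \<open>The lower left entry of \<open>A\<close> times the inverse of \<open>B\<close> is the
  determinant of their bottom rows, so the coset condition is equality of points. Finiteness comes
  from the enumeration by base translates.\<close>

lemma coset_action_SL2Z:
  assumes p: "prime p"
  shows "coset_action SL2Z (Gamma0 p) (\<lambda>A. P1_point p (A$2))"
proof (intro coset_action.intro coset_action_axioms.intro)
  show "P1_point p (A$2) = P1_point p (B$2) \<longleftrightarrow> A \<otimes>\<^bsub>SL2Z\<^esub> inv\<^bsub>SL2Z\<^esub> B \<in> Gamma0 p"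
    if "A \<in> carrier SL2Z" "B \<in> carrier SL2Z" for A B
  proof -
    have "det (A ** inv\<^bsub>SL2Z\<^esub> B) = 1"
      using that group.inv_closed[OF group_SL2Z, of B] by (simp add: det_mul)
    moreover have "(A ** inv\<^bsub>SL2Z\<^esub> B)$2$1 = A$2$1 * B$2$2 - A$2$2 * B$2$1"
      using that by (simp add: inv_SL2Z mat2_mult_nth)
    ultimately show ?thesis
      using that by (simp add: in_Gamma0_iff P1_point_eq_iff[OF p] red_row_nonzero[OF p])
  qed
  show "finite ((\<lambda>A. P1_point p (A$2)) ` carrier SL2Z)"
    using bij_betw_finite[OF bij_base_translate[OF p]] by simp
qed (simp_all add: group_SL2Z subgroup_Gamma0)

section \<open>Conjugation by rational matrices\<close>

lemma rat_mat_nth: "rat_mat A $ i $ j = rat_of_int (A$i$j)"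
  by (simp add: rat_mat_def map_matrix_def)

lemma rat_mat_mult: "rat_mat (A ** B) = rat_mat A ** rat_mat B"
  by (simp add: mat2_eq_iff mat2_mult_nth rat_mat_nth)

lemma rat_mat_eq_iff: "rat_mat A = rat_mat B \<longleftrightarrow> A = B"
  by (simp add: mat2_eq_iff rat_mat_nth)

text \<open>Clearing the rational inverse leaves an equation between integer matrices.\<close>

lemma conj_eq_iff:
  assumes "det h \<noteq> 0"
  shows "conj_eq h A B \<longleftrightarrow> B ** h = h ** A"
proof -
  have "det (rat_mat h) = rat_of_int (det h)"
    by (simp add: det_2 rat_mat_nth)
  then have "invertible (rat_mat h)"
    using assms by (simp add: invertible_det_nz)
  then have inv: "rat_mat h ** matrix_inv (rat_mat h) = mat 1" "matrix_inv (rat_mat h) ** rat_mat h = mat 1"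
    unfolding invertible_def matrix_inv_def by (rule someI2_ex, simp)+
  have "conj_eq h A B \<longleftrightarrow> rat_mat B ** rat_mat h = rat_mat h ** rat_mat A"
    unfolding conj_eq_def by (metis inv matrix_mul_assoc matrix_mul_rid)
  then show ?thesis
    by (simp add: rat_mat_eq_iff flip: rat_mat_mult)
qed

lemma int_conj_eq:
  assumes "det h \<noteq> 0" "B ** h = h ** A"
  shows "int_conj h A = B"
  unfolding int_conj_def
proof (rule the_equality)
  show "conj_eq h A B" using assms by (simp add: conj_eq_iff)
  then show "C = B" if "conj_eq h A C" for C
    using that by (simp add: conj_eq_def flip: rat_mat_eq_iff)
qed

section \<open>Conjugation by \<open>g_mat p\<close> as a homomorphism on
  \<open>Gamma0 p\<close>\<close>

lemma det_g_mat: "det (g_mat p) = int p"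
  by (simp add: g_mat_def det_2)

lemma pi_op_spec:
  assumes p: "prime p" and B: "B \<in> Gamma0 p"
  shows pi_op_closed: "pi_op p B \<in> carrier SL2Z"
    and pi_op_mult: "pi_op p B ** g_mat p = g_mat p ** B"
proof -
  have p0: "p > 0" using p by (simp add: prime_gt_0_nat)
  obtain c where c: "B$2$1 = int p * c" using B by (auto simp: in_Gamma0_iff)
  \<comment> \<open>Conjugation by the diagonal matrix multiplies the upper right entry by
    \<open>p\<close> and divides the lower left one by \<open>p\<close>; the latter is integral by
    the definition of \<open>Gamma0 p\<close>.\<close>
  define C :: "int^2^2" where "C = vector [vector [B$1$1, int p * B$1$2], vector [c, B$2$2]]"
  have C: "C ** g_mat p = g_mat p ** B"
    by (simp add: C_def mat2_eq_iff mat2_mult_nth g_mat_def c)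
  have "det C = det B" by (simp add: C_def det_2 c)
  then have "det C = 1" using B by (simp add: in_Gamma0_iff)
  moreover have "pi_op p B = C"
    unfolding pi_op_def using C p0 by (intro int_conj_eq) (auto simp: det_g_mat)
  ultimately show "pi_op p B \<in> carrier SL2Z" "pi_op p B ** g_mat p = g_mat p ** B"
    using C by auto
qed

text \<open>The relation \<open>pi_op_mult\<close> determines the value of \<open>pi_op\<close>, and
  it is inherited by products.\<close>

lemma pi_op_hom:
  assumes p: "prime p"
  shows "pi_op p \<in> hom (Gamma0_grp p) SL2Z"
proof (rule homI)
  fix A B assume AB: "A \<in> carrier (Gamma0_grp p)" "B \<in> carrier (Gamma0_grp p)"
  have "(pi_op p A ** pi_op p B) ** g_mat p = pi_op p A ** g_mat p ** B"
    using AB by (simp add: pi_op_mult[OF p] matrix_mul_assoc[symmetric])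
      (simp add: pi_op_mult[OF p] matrix_mul_assoc)
  also have "\<dots> = g_mat p ** (A ** B)"
    using AB by (simp add: pi_op_mult[OF p] matrix_mul_assoc)
  finally show "pi_op p (A \<otimes>\<^bsub>Gamma0_grp p\<^esub> B) = pi_op p A \<otimes>\<^bsub>SL2Z\<^esub> pi_op p B"
    using p int_conj_eq[of "g_mat p" "pi_op p A ** pi_op p B" "A ** B"]
    by (simp add: pi_op_def det_g_mat)
qed (use pi_op_closed[OF p] in simp)

text \<open>Conjugating by \<open>gamma_mat j\<close> and then by \<open>g_mat p\<close> is one
  conjugation by the product; this matches the pushed forward terms with
  \<open>int_conj\<close>.\<close>

lemma conj_eq_g_gamma:
  assumes p: "prime p" and A: "A \<in> carrier SL2Z"
    and B: "gamma_mat j \<otimes>\<^bsub>SL2Z\<^esub> A \<otimes>\<^bsub>SL2Z\<^esub> inv\<^bsub>SL2Z\<^esub> gamma_mat j \<in> Gamma0 p" (is "?B \<in> _")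
  shows "conj_eq (g_mat p ** gamma_mat j) A (pi_op p ?B)"
    and "int_conj (g_mat p ** gamma_mat j) A = pi_op p ?B"
proof -
  have inv: "inv\<^bsub>SL2Z\<^esub> gamma_mat j ** gamma_mat j = mat 1"
    using group.l_inv[OF group_SL2Z, of "gamma_mat j"] by (simp add: det_gamma_mat)
  have "pi_op p ?B ** (g_mat p ** gamma_mat j) = g_mat p ** (?B ** gamma_mat j)"
    using pi_op_mult[OF p B] by (simp only: matrix_mul_assoc)
  also have "?B ** gamma_mat j = gamma_mat j ** A"
    by (simp add: inv flip: matrix_mul_assoc)
  finally have *: "pi_op p ?B ** (g_mat p ** gamma_mat j) = (g_mat p ** gamma_mat j) ** A"
    by (simp only: matrix_mul_assoc)
  have "det (g_mat p ** gamma_mat j) \<noteq> 0"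
    using p by (auto simp: det_mul det_g_mat det_gamma_mat)
  with * show "conj_eq (g_mat p ** gamma_mat j) A (pi_op p ?B)"
    "int_conj (g_mat p ** gamma_mat j) A = pi_op p ?B"
    by (auto simp: conj_eq_iff int_conj_eq)
qed

section \<open>Formulas for the pullback, \<open>e_op\<close> and \<open>hecke_T\<close>\<close>

theorem proposition10p2:
  fixes p :: nat and \<alpha> :: "int^2^2" and d :: "nat \<Rightarrow> nat" and S :: "nat set"
  assumes "prime p"
    and "\<alpha> \<in> carrier SL2Z"
    and "\<And>j. j \<le> p \<Longrightarrow> d j = card (P1_orbit p \<alpha> (base_translate p j))"
    and "S \<subseteq> {0..p}"
    and "orbit_reps p \<alpha> (base_translate p ` S)"
  shows
    "(pi_pull p (cls SL2Z \<alpha>) \<in> Z_lambda (Gamma0_grp p) \<and>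
      pi_pull p (cls SL2Z \<alpha>) =
        (\<Sum>k\<in>S. cls (Gamma0_grp p)
           (gamma_mat k \<otimes>\<^bsub>SL2Z\<^esub> (\<alpha> [^]\<^bsub>SL2Z\<^esub> d k) \<otimes>\<^bsub>SL2Z\<^esub> inv\<^bsub>SL2Z\<^esub> gamma_mat k)) \<and>
      to_rat (pi_pull p (cls SL2Z \<alpha>)) =
        (\<Sum>j=0..p. qcls (Gamma0_grp p)
           (gamma_mat j \<otimes>\<^bsub>SL2Z\<^esub> (\<alpha> [^]\<^bsub>SL2Z\<^esub> d j) \<otimes>\<^bsub>SL2Z\<^esub> inv\<^bsub>SL2Z\<^esub> gamma_mat j)
           (1 / of_nat (d j))))
   \<and> (e_op p (cls SL2Z \<alpha>) \<in> Z_lambda SL2Z \<and>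
      e_op p (cls SL2Z \<alpha>) =
        - cls SL2Z \<alpha> + (\<Sum>k\<in>S. cls SL2Z (\<alpha> [^]\<^bsub>SL2Z\<^esub> d k)) \<and>
      to_rat (e_op p (cls SL2Z \<alpha>)) =
        - qcls SL2Z \<alpha> 1 + (\<Sum>j=0..p. qcls SL2Z (\<alpha> [^]\<^bsub>SL2Z\<^esub> d j) (1 / of_nat (d j))))
   \<and> (hecke_T p (cls SL2Z \<alpha>) \<in> Z_lambda SL2Z \<and>
      (\<forall>j\<le>p. \<exists>B\<in>carrier SL2Z. conj_eq (g_mat p ** gamma_mat j) (\<alpha> [^]\<^bsub>SL2Z\<^esub> d j) B) \<and>
      hecke_T p (cls SL2Z \<alpha>) =
        (\<Sum>k\<in>S. cls SL2Z (int_conj (g_mat p ** gamma_mat k) (\<alpha> [^]\<^bsub>SL2Z\<^esub> d k))) \<and>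
      to_rat (hecke_T p (cls SL2Z \<alpha>)) =
        (\<Sum>j=0..p. qcls SL2Z (int_conj (g_mat p ** gamma_mat j) (\<alpha> [^]\<^bsub>SL2Z\<^esub> d j))
           (1 / of_nat (d j))))"
proof -
  note p = assms(1) and \<alpha> = assms(2)
  interpret coset_action SL2Z "Gamma0 p" "\<lambda>A. P1_point p (A$2)"
    by (rule coset_action_SL2Z[OF p])
  let ?x = "\<lambda>j. gamma_mat j \<otimes>\<^bsub>SL2Z\<^esub> (\<alpha> [^]\<^bsub>SL2Z\<^esub> d j) \<otimes>\<^bsub>SL2Z\<^esub> inv\<^bsub>SL2Z\<^esub> gamma_mat j"
  have \<gamma>: "gamma_mat j \<in> carrier SL2Z" for j
    by (simp add: det_gamma_mat)
  \<comment> \<open>Taking bottom rows is equivariant, which identifies \<open>P1_orbit\<close> with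
    the abstract \<open>orb\<close>.\<close>
  have row: "(A ** B)$2 = A$2 v* B" for A B :: "int^2^2"
    by (simp add: vec_eq_iff mat2_mult_nth vector_mult_mat2_nth)
  have orb: "P1_orbit p \<alpha> (P1_point p (A$2)) = orb \<alpha> A" for A
    by (simp add: P1_orbit_def orb_def image_image P1_act_point row)
  have d: "d j = return_exp SL2Z (Gamma0 p) \<alpha> (gamma_mat j)" if "j \<le> p" for j
    using assms(3)[OF that] card_orb[OF \<alpha> \<gamma>] by (simp add: base_translate_eq orb)
  have x: "?x j \<in> Gamma0 p" if "j \<le> p" for j
    using conj_return_in[OF \<alpha> \<gamma>] by (simp only: d[OF that])
  have inj: "inj_on (base_translate p) S"
    using bij_betw_imp_inj_on[OF bij_base_translate[OF p]] assms(4) by (rule inj_on_subset)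
  have reps: "\<exists>!k. k \<in> S \<and> P1_point p (A$2) \<in> orb \<alpha> (gamma_mat k)" if A: "A \<in> carrier SL2Z" for A
  proof -
    have "P1_point p (A$2) \<in> P1 p"
      using A red_row_nonzero[OF p] by (auto simp: P1_def)
    then have "orb \<alpha> A \<in> P1_orbit p \<alpha> ` P1 p"
      unfolding orb[symmetric] by (rule imageI)
    then have "\<exists>!P. P \<in> base_translate p ` S \<and> P \<in> orb \<alpha> A"
      using assms(5) by (simp only: orbit_reps_def)
    then have "\<exists>!k. k \<in> S \<and> base_translate p k \<in> orb \<alpha> A"
      using inj by (elim ex1E) (auto intro!: ex1I dest: inj_onD)
    \<comment> \<open>Lying in a common orbit is symmetric; this exchanges the orbit of
      \<open>A\<close>, as in \<open>orbit_reps\<close>, for the orbit of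
      \<open>gamma_mat k\<close>, as in \<open>pull_cls\<close>.\<close>
    moreover have "base_translate p k \<in> orb \<alpha> A \<longleftrightarrow> P1_point p (A$2) \<in> orb \<alpha> (gamma_mat k)" for k
      unfolding base_translate_eq pt_in_orb_iff[OF \<alpha> A \<gamma>] pt_in_orb_iff[OF \<alpha> \<gamma> A]
      by (rule eq_commute)
    ultimately show ?thesis by (simp only:)
  qed
  have pull: "pi_pull p (cls SL2Z \<alpha>) = (\<Sum>k\<in>S. cls (Gamma0_grp p) (?x k))"
  proof -
    have "pull SL2Z (Gamma0 p) (cls SL2Z \<alpha>) = (\<Sum>k\<in>S. cls (Gamma0_grp p) (gamma_mat k \<otimes>\<^bsub>SL2Z\<^esub>
        (\<alpha> [^]\<^bsub>SL2Z\<^esub> return_exp SL2Z (Gamma0 p) \<alpha> (gamma_mat k)) \<otimes>\<^bsub>SL2Z\<^esub> inv\<^bsub>SL2Z\<^esub> gamma_mat k))"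
      by (rule pull_cls[OF \<alpha> \<gamma> reps])
    also have "\<dots> = (\<Sum>k\<in>S. cls (Gamma0_grp p) (?x k))"
      using assms(4) by (intro sum.cong) (auto simp: d)
    finally show ?thesis unfolding pi_pull_def .
  qed
  have push: "push K \<psi> (pi_pull p (cls SL2Z \<alpha>)) = (\<Sum>k\<in>S. cls K (\<psi> (?x k)))"
    if "group K" "\<psi> \<in> hom (Gamma0_grp p) K" for K \<psi>
    unfolding pull push_sum
    using assms(4) x by (intro sum.cong push_cls[OF group_H that]) auto
  \<comment> \<open>A general homomorphism \<open>\<psi>\<close> serves all three formulas: the
    identity of \<open>Gamma0 p\<close>, its inclusion, and \<open>pi_op p\<close>.\<close>
  have average: "(\<Sum>k\<in>S. qcls K (\<psi> (?x k)) 1) = (\<Sum>j=0..p. qcls K (\<psi> (?x j)) (1 / of_nat (d j)))"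
    if K: "group K" and \<psi>: "\<psi> \<in> hom (Gamma0_grp p) K" for K :: "(int^2^2) monoid" and \<psi>
  proof -
    have "(\<Sum>k\<in>S. qcls K (\<psi> (?x k)) 1) = (\<Sum>j=0..p. qcls K (\<psi> (?x j))
           (1 / of_nat (return_exp SL2Z (Gamma0 p) \<alpha> (gamma_mat j))))"
      unfolding qcls_def
    proof (rule sum_orbit_average[where \<gamma> = gamma_mat, OF \<alpha> assms(4) \<gamma> _ reps])
      show "bij_betw (\<lambda>j. P1_point p (gamma_mat j $ 2)) {0..p} ((\<lambda>A. P1_point p (A$2)) ` carrier SL2Z)"
        using bij_base_translate[OF p] by (simp add: base_translate_eq[abs_def])
      fix j k assume jk: "j \<in> {0..p}" "k \<in> {0..p}" "P1_point p (gamma_mat j $ 2) \<in> orb \<alpha> (gamma_mat k)"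
      then have "conj_class (Gamma0_grp p) (?x j) = conj_class (Gamma0_grp p) (?x k)"
        using conj_class_return_cong[OF \<alpha> \<gamma> \<gamma> jk(3)] by (simp add: d)
      then show "conj_class K (\<psi> (?x j)) = conj_class K (\<psi> (?x k))"
        using jk x by (intro conj_class_hom[OF group_H K \<psi>]) auto
    qed
    then show ?thesis by (simp add: d)
  qed
  have id: "(\<lambda>A. A) \<in> hom (Gamma0_grp p) (Gamma0_grp p)" "(\<lambda>A. A) \<in> hom (Gamma0_grp p) SL2Z"
    by (auto simp: hom_def in_Gamma0_iff)
  have power: "\<alpha> [^]\<^bsub>SL2Z\<^esub> (n::nat) \<in> carrier SL2Z" for n
    using \<alpha> by (rule nat_pow_closed)
  \<comment> \<open>In the full modular group \<open>gamma_mat j\<close> is itself a conjugator, so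
    it disappears from the formula for \<open>e_op\<close>.\<close>
  have conj: "conj_class SL2Z (?x j) = conj_class SL2Z (\<alpha> [^]\<^bsub>SL2Z\<^esub> d j)" for j
    by (rule conj_class_eq[OF power \<gamma>])
  have e: "e_op p (cls SL2Z \<alpha>) = (\<Sum>k\<in>S. cls SL2Z (\<alpha> [^]\<^bsub>SL2Z\<^esub> d k)) - cls SL2Z \<alpha>"
    unfolding e_op_def push[OF group_SL2Z id(2)] by (simp only: cls_def conj)
  have hecke: "hecke_T p (cls SL2Z \<alpha>) = (\<Sum>k\<in>S. cls SL2Z (pi_op p (?x k)))"
    unfolding hecke_T_def by (rule push[OF group_SL2Z pi_op_hom[OF p]])
  note g\<gamma> = conj_eq_g_gamma[OF p power x]
  have S: "k \<le> p" if "k \<in> S" for k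
    using assms(4) that by auto
  show ?thesis
  proof (intro conjI allI impI)
    show "pi_pull p (cls SL2Z \<alpha>) \<in> Z_lambda (Gamma0_grp p)"
      unfolding pull using x S by (intro Z_lambda_sum cls_in_Z_lambda) auto
    show "pi_pull p (cls SL2Z \<alpha>) = (\<Sum>k\<in>S. cls (Gamma0_grp p) (?x k))"
      by (rule pull)
    show "to_rat (pi_pull p (cls SL2Z \<alpha>)) =
        (\<Sum>j=0..p. qcls (Gamma0_grp p) (?x j) (1 / of_nat (d j)))"
      unfolding pull to_rat_sum to_rat_cls by (rule average[OF group_H id(1)])
    show "e_op p (cls SL2Z \<alpha>) \<in> Z_lambda SL2Z"
      unfolding e using \<alpha> power by (intro Z_lambda_diff Z_lambda_sum cls_in_Z_lambda)
    show "e_op p (cls SL2Z \<alpha>) = - cls SL2Z \<alpha> + (\<Sum>k\<in>S. cls SL2Z (\<alpha> [^]\<^bsub>SL2Z\<^esub> d k))"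
      unfolding e by simp
    show "to_rat (e_op p (cls SL2Z \<alpha>)) =
        - qcls SL2Z \<alpha> 1 + (\<Sum>j=0..p. qcls SL2Z (\<alpha> [^]\<^bsub>SL2Z\<^esub> d j) (1 / of_nat (d j)))"
      unfolding e to_rat_diff to_rat_sum to_rat_cls
      using average[OF group_SL2Z id(2)] by (simp only: qcls_def conj) simp
    show "hecke_T p (cls SL2Z \<alpha>) \<in> Z_lambda SL2Z"
      unfolding hecke using x S by (intro Z_lambda_sum cls_in_Z_lambda pi_op_closed[OF p]) auto
    show "\<exists>B\<in>carrier SL2Z. conj_eq (g_mat p ** gamma_mat j) (\<alpha> [^]\<^bsub>SL2Z\<^esub> d j) B"
      if "j \<le> p" for j
      using g\<gamma>(1)[OF that] pi_op_closed[OF p x[OF that]] by blast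
    show "hecke_T p (cls SL2Z \<alpha>) =
        (\<Sum>k\<in>S. cls SL2Z (int_conj (g_mat p ** gamma_mat k) (\<alpha> [^]\<^bsub>SL2Z\<^esub> d k)))"
      unfolding hecke using g\<gamma>(2)[OF S] by (intro sum.cong) simp_all
    show "to_rat (hecke_T p (cls SL2Z \<alpha>)) =
        (\<Sum>j=0..p. qcls SL2Z (int_conj (g_mat p ** gamma_mat j) (\<alpha> [^]\<^bsub>SL2Z\<^esub> d j))
           (1 / of_nat (d j)))"
      unfolding hecke to_rat_sum to_rat_cls average[OF group_SL2Z pi_op_hom[OF p]]
      using g\<gamma>(2) by (intro sum.cong) simp_all
  qed
qed

end
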